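(* Let $\mathcal{C}\subset\mathbb{R}^d$ be a compact convex set, let $F(\theta)=\max_{y\in\mathcal{C}}\langle y,\theta\rangle$ be its support function, and for every $p\in\mathcal{P}$ let $\mathcal{C}(p)\subseteq\mathcal{C}$ be a convex constraint subset. Then the partial Fenchel-Young loss $\bar L_{\mathrm{FY}}(\theta;p)=\min_{y\in\mathcal{C}(p)}L_{\mathrm{FY}}(\theta;y)$ satisfies: 1. The loss is a difference of convex functions in $\theta$, given explicitly by $$\bar L_{\mathrm{FY}}(\theta;p)=F(\theta)-F(\theta;p),\qquad\text{where}\quad F(\theta;p)=\max_{y\in\mathcal{C}(p)}\langle y,\theta\rangle .$$ 2. The gradient with respect to $\theta$ is given by $$\nabla_\theta\bar L_{\mathrm{FY}}(\theta;p)=y^*(\theta)-y^*(\theta;p),\qquad\text{where}\quad y^*(\theta;p)=\operatorname{argmax}_{y\in\mathcal{C}(p)}\langle y,\theta\rangle$$ (this holds almost everywhere, namely when the argmax is unique). 3. The perturbed partial Fenchel-Young loss given by $\bar L_{\mathrm{FY},\varepsilon}(\theta;p)=\mathbf{E}[\bar L_{\mathrm{FY}}(\theta+\varepsilon Z;p)]$ satisfies $$\nabla_\theta\bar L_{\mathrm{FY},\varepsilon}(\theta;p)=y^*_\varepsilon(\theta)-y^*_\varepsilon(\theta;p),\qquad\text{where}\quad y^*_\varepsilon(\theta;p)=\mathbf{E}\big[\operatorname{argmax}_{y\in\mathcal{C}(p)}\langle y,\theta+\varepsilon Z\rangle\big].$$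
   Context: For a convex function $F$ on $\mathbb{R}^d$ with Fenchel dual $F^*$, the Fenchel-Young loss between a score $\theta\in\mathbb{R}^d$ and a label $y$ is $L_{\mathrm{FY}}(\theta;y)=F(\theta)-\langle\theta,y\rangle+F^*(y)$. When $F$ is the support function of $\mathcal{C}$, $F^*$ is the indicator function of $\mathcal{C}$ ($0$ on $\mathcal{C}$, $+\infty$ outside), so $L_{\mathrm{FY}}(\theta;y)=F(\theta)-\langle\theta,y\rangle$ if $y\in\mathcal{C}$ and $+\infty$ otherwise. An element $p\in\mathcal{P}$ represents partial information about an unknown ground-truth label, and $\mathcal{C}(p)$ is the set of labels consistent with it. The unconstrained maximizers are $y^*(\theta)=\operatorname{argmax}_{y\in\mathcal{C}}\langle y,\theta\rangle$ and $y^*_\varepsilon(\theta)=\mathbf{E}\big[\operatorname{argmax}_{y\in\mathcal{C}}\langle y,\theta+\varepsilon Z\rangle\big]$. Here $\varepsilon>0$ and $Z$ is a random perturbation whose distribution has a positive, differentiable density on the space $\mathbb{R}^d$ in which $\theta$ lives.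
   Formalization: Each C(p) is assumed nonempty and closed (otherwise the max may not exist, or a unique argmax need not give a gradient), and item 3 assumes the expectation defining the perturbed loss at θ is finite (it is infinite, for example, for some Cauchy-distributed Z). *)

theory Defs
  imports "HOL-Probability.Probability"
begin

definition support_fun :: "'a::real_inner set \<Rightarrow> 'a \<Rightarrow> real" where
  "support_fun S \<theta> = (SUP y\<in>S. y \<bullet> \<theta>)"

definition fenchel_conjugate :: "('a::real_inner \<Rightarrow> real) \<Rightarrow> 'a \<Rightarrow> ereal" where
  "fenchel_conjugate F y = (SUP \<theta>. ereal (\<theta> \<bullet> y - F \<theta>))"

definition FY_loss :: "('a::real_inner \<Rightarrow> real) \<Rightarrow> 'a \<Rightarrow> 'a \<Rightarrow> ereal" where
  "FY_loss F \<theta> y = ereal (F \<theta> - \<theta> \<bullet> y) + fenchel_conjugate F y"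

definition partial_FY_loss :: "('a::real_inner \<Rightarrow> real) \<Rightarrow> 'a set \<Rightarrow> 'a \<Rightarrow> ereal" where
  "partial_FY_loss F S \<theta> = (INF y\<in>S. FY_loss F \<theta> y)"

definition unique_argmax :: "'a::real_inner set \<Rightarrow> 'a \<Rightarrow> bool" where
  "unique_argmax S \<theta> \<longleftrightarrow> (\<exists>!y. is_arg_max (\<lambda>y. y \<bullet> \<theta>) (\<lambda>y. y \<in> S) y)"

text \<open>The value 0 is a mere convention for those \<open>\<theta>\<close> whose maximizer is not unique. A fixed
  value, rather than an arbitrary choice of maximizer for each \<open>\<theta>\<close>, keeps the
  function Borel measurable, so that its expectation is a meaningful Bochner integral.\<close>
definition argmax_point :: "'a::real_inner set \<Rightarrow> 'a \<Rightarrow> 'a" where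
  "argmax_point S \<theta> =
     (if unique_argmax S \<theta> then THE y. is_arg_max (\<lambda>y. y \<bullet> \<theta>) (\<lambda>y. y \<in> S) y else 0)"

definition perturbed_argmax ::
  "'w measure \<Rightarrow> ('w \<Rightarrow> 'a::euclidean_space) \<Rightarrow> real \<Rightarrow> 'a set \<Rightarrow> 'a \<Rightarrow> 'a" where
  "perturbed_argmax M Z \<epsilon> S \<theta> = (LINT \<omega>|M. argmax_point S (\<theta> + \<epsilon> *\<^sub>R Z \<omega>))"

text \<open>The partial loss is extended-real-valued; \<open>real_of_ereal\<close> is only meaningful where
  it is finite.\<close>
definition perturbed_partial_FY_loss ::
  "'w measure \<Rightarrow> ('w \<Rightarrow> 'a::euclidean_space) \<Rightarrow> real \<Rightarrow> ('a \<Rightarrow> real) \<Rightarrow> 'a set \<Rightarrow> 'a \<Rightarrow> real" where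
  "perturbed_partial_FY_loss M Z \<epsilon> F S \<theta> =
     (LINT \<omega>|M. real_of_ereal (partial_FY_loss F S (\<theta> + \<epsilon> *\<^sub>R Z \<omega>)))"

end

theory Submission
  imports Defs
begin

text \<open>The conjugate of \<open>support_fun C\<close> vanishes on \<open>C\<close>, so the partial loss is a difference of two
  support functions. A support function is differentiable wherever its maximizer is unique,
  because by compactness the maximizers at nearby points are close to that one (Danskin).
  Uniqueness almost everywhere needs no Rademacher theorem: along a line in a direction \<open>e\<close>
  the inner products \<open>y \<bullet> e\<close> of the maximizers \<open>y\<close> increase within a bounded range, so only finitely many
  points of the line have maximizers differing by at least \<open>\<delta>\<close> along \<open>e\<close>. By Fubini and translation
  invariance such points form a null set. The perturbed gradient then follows by dominated
  convergence, since the partial loss is Lipschitz.\<close>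

text \<open>An equation with \<open>support_fun\<close> replaces \<open>is_arg_max\<close>: it is a
  closed condition in \<open>y\<close> and \<open>\<theta>\<close> jointly when \<open>S\<close> is
  nonempty and compact, and \<open>is_arg_max_iff\<close> shows that the two notions then
  agree.\<close>

definition argmax_set :: "'a::real_inner set \<Rightarrow> 'a \<Rightarrow> 'a set" where
  "argmax_set S \<theta> = {y \<in> S. y \<bullet> \<theta> = support_fun S \<theta>}"

text \<open>The threshold \<open>\<delta>\<close> makes non-uniqueness quantitative. For compact
  \<open>S\<close> and \<open>\<delta> > 0\<close> this set is closed and finite on lines along
  \<open>e\<close>; neither is guaranteed for the set of all points with several maximizers.\<close>

definition ambiguous :: "'a::real_inner set \<Rightarrow> 'a \<Rightarrow> real \<Rightarrow> 'a set" where
  "ambiguous S e \<delta> = {\<theta>. \<exists>y\<in>argmax_set S \<theta>. \<exists>z\<in>argmax_set S \<theta>. \<delta> \<le> (y - z) \<bullet> e}"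

section \<open>Differentiation under the integral sign\<close>

lemma GDERIV_integral:
  fixes g :: "'a::euclidean_space \<Rightarrow> 'w \<Rightarrow> real" and D :: "'w \<Rightarrow> 'a"
  assumes int_g: "\<And>x. integrable M (g x)" and int_D: "integrable M D" and int_B: "integrable M B"
    and deriv: "AE \<omega> in M. GDERIV (\<lambda>x. g x \<omega>) \<theta> :> D \<omega>"
    and lipschitz: "\<And>x y \<omega>. \<bar>g x \<omega> - g y \<omega>\<bar> \<le> B \<omega> * norm (x - y)"
  shows "GDERIV (\<lambda>x. LINT \<omega>|M. g x \<omega>) \<theta> :> (LINT \<omega>|M. D \<omega>)"
proof -
  \<comment> \<open>\<open>r v\<close> is the normalized first-order remainder at
    \<open>\<theta>\<close>. It tends to 0 wherever the gradient exists, and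
    \<open>B + norm D\<close> will dominate it.\<close>
  define r where "r v \<omega> = norm (g (\<theta> + v) \<omega> - g \<theta> \<omega> - v \<bullet> D \<omega>) / norm v" for v \<omega>
  have int_D': "integrable M (\<lambda>\<omega>. v \<bullet> D \<omega>)" for v
    using int_D by simp
  have [measurable]: "g x \<in> borel_measurable M" "D \<in> borel_measurable M" for x
    using int_g int_D by auto
  have meas_r [measurable]: "r v \<in> borel_measurable M" for v
    unfolding r_def by measurable
  have r_bound: "norm (r v \<omega>) \<le> B \<omega> + norm (D \<omega>)" if "v \<noteq> 0" for v \<omega>
  proof -
    have "\<bar>g (\<theta> + v) \<omega> - g \<theta> \<omega> - v \<bullet> D \<omega>\<bar> \<le> \<bar>g (\<theta> + v) \<omega> - g \<theta> \<omega>\<bar> + \<bar>v \<bullet> D \<omega>\<bar>"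
      by simp
    also have "\<dots> \<le> B \<omega> * norm v + norm v * norm (D \<omega>)"
      using lipschitz[of "\<theta> + v" \<omega> \<theta>] Cauchy_Schwarz_ineq2[of v "D \<omega>"] by simp
    finally show ?thesis
      using that by (simp add: r_def field_simps)
  qed
  have lim: "((\<lambda>v. LINT \<omega>|M. r v \<omega>) \<longlongrightarrow> 0) (at 0)"
    \<comment> \<open>Dominated convergence concerns sequences, so the limit is tested along an
      arbitrary sequence of nonzero \<open>X i\<close> tending to 0.\<close>
    unfolding tendsto_at_iff_sequentially comp_def
  proof (intro allI impI)
    fix X :: "nat \<Rightarrow> 'a"
    assume X: "\<forall>i. X i \<in> UNIV - {0}" "X \<longlonglongrightarrow> 0"
    have "(\<lambda>i. LINT \<omega>|M. r (X i) \<omega>) \<longlonglongrightarrow> (LINT \<omega>|M. 0)"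
    proof (rule integral_dominated_convergence)
      show "integrable M (\<lambda>\<omega>. B \<omega> + norm (D \<omega>))"
        using int_B int_D by auto
      show "AE \<omega> in M. (\<lambda>i. r (X i) \<omega>) \<longlonglongrightarrow> 0"
        using deriv
      proof eventually_elim
        case (elim \<omega>)
        have "((\<lambda>v. r v \<omega>) \<longlongrightarrow> 0) (at 0)"
          using elim unfolding gderiv_def has_derivative_at r_def by simp
        then show ?case
          using X unfolding tendsto_at_iff_sequentially comp_def by blast
      qed
    qed (use X r_bound in auto)
    then show "(\<lambda>i. LINT \<omega>|M. r (X i) \<omega>) \<longlonglongrightarrow> 0" by simp
  qed
  have int_r: "integrable M (r v)" for v
    unfolding r_def by (intro integrable_divide integrable_norm Bochner_Integration.integrable_diff int_g int_D')
  have "((\<lambda>v. norm ((LINT \<omega>|M. g (\<theta> + v) \<omega>) - (LINT \<omega>|M. g \<theta> \<omega>) - v \<bullet> (LINT \<omega>|M. D \<omega>)) / norm v)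
           \<longlongrightarrow> 0) (at 0)"
  \<comment> \<open>The remainder of the integral is the integral of the remainder, so its norm is
    at most the integral of the norm.\<close>
  proof (rule tendsto_sandwich[OF _ _ tendsto_const lim])
    show "\<forall>\<^sub>F v in at 0. norm ((LINT \<omega>|M. g (\<theta> + v) \<omega>) - (LINT \<omega>|M. g \<theta> \<omega>) - v \<bullet> (LINT \<omega>|M. D \<omega>)) / norm v
            \<le> (LINT \<omega>|M. r v \<omega>)"
    proof (intro always_eventually allI)
      fix v
      have "(LINT \<omega>|M. g (\<theta> + v) \<omega>) - (LINT \<omega>|M. g \<theta> \<omega>) - v \<bullet> (LINT \<omega>|M. D \<omega>)
          = (LINT \<omega>|M. g (\<theta> + v) \<omega> - g \<theta> \<omega> - v \<bullet> D \<omega>)"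
        using int_g int_D int_D' by simp
      also have "norm \<dots> \<le> (LINT \<omega>|M. norm (g (\<theta> + v) \<omega> - g \<theta> \<omega> - v \<bullet> D \<omega>))"
        by (rule integral_norm_bound)
      finally show "norm ((LINT \<omega>|M. g (\<theta> + v) \<omega>) - (LINT \<omega>|M. g \<theta> \<omega>) - v \<bullet> (LINT \<omega>|M. D \<omega>)) / norm v
            \<le> (LINT \<omega>|M. r v \<omega>)"
        by (simp add: r_def divide_right_mono)
    qed
  qed auto
  then show ?thesis
    unfolding gderiv_def has_derivative_at by (auto intro: bounded_linear_inner_left)
qed

section \<open>Lebesgue null sets under affine maps and along lines\<close>

lemma AE_lborel_affine:
  fixes t :: "'a::euclidean_space"
  assumes "c \<noteq> 0" and A: "A \<in> sets borel" and "AE x in lborel. x \<in> A"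
  shows "AE x in lborel. t + c *\<^sub>R x \<in> A"
proof -
  \<comment> \<open>Lebesgue measure is its own affine image scaled by the constant
    \<open>\<bar>c\<bar> ^ DIM('a)\<close>. This factor is positive, so dropping it keeps the null
    sets.\<close>
  have "AE x in density (distr lborel borel (\<lambda>x. t + c *\<^sub>R x)) (\<lambda>_. \<bar>c\<bar> ^ DIM('a)). x \<in> A"
    using assms(3) by (subst lborel_affine[OF assms(1), of t, symmetric])
  then have "AE x in distr lborel borel (\<lambda>x. t + c *\<^sub>R x). x \<in> A"
    using assms(1) by (simp add: AE_density)
  then show ?thesis
    using A by (subst (asm) AE_distr_iff) auto
qed

text \<open>The law of \<open>Z\<close> has a density, so it inherits every almost-everywhere
  statement about Lebesgue measure.\<close>

lemma AE_distributed_lborel_affine: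
  fixes Z :: "'w \<Rightarrow> 'a::euclidean_space"
  assumes Z: "distributed M lborel Z f" and "c \<noteq> 0" and A: "A \<in> sets borel"
    and "AE x in lborel. x \<in> A"
  shows "AE \<omega> in M. t + c *\<^sub>R Z \<omega> \<in> A"
proof -
  have [measurable]: "Z \<in> measurable M lborel" "f \<in> borel_measurable lborel"
    using Z by (auto simp: distributed_def)
  have "AE x in density lborel f. t + c *\<^sub>R x \<in> A"
    using AE_lborel_affine[OF assms(2-4), of t] by (auto simp: AE_density elim: eventually_mono)
  then have "AE x in distr M lborel Z. t + c *\<^sub>R x \<in> A"
    using Z unfolding distributed_def by metis
  then show ?thesis
    using A by (subst (asm) AE_distr_iff[OF \<open>Z \<in> measurable M lborel\<close>]) auto
qed

text \<open>For each \<open>x\<close>, almost every \<open>t\<close> keeps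
  \<open>x + t *\<^sub>R e\<close> out of \<open>A\<close>. Exchanging the two quantifiers gives one
  \<open>t\<close> that does so for almost every \<open>x\<close>, that is, a translate of
  \<open>A\<close> is null.\<close>

lemma AE_lborel_finite_on_lines:
  fixes e :: "'a::euclidean_space"
  assumes A: "A \<in> sets borel" and fin: "\<And>x. finite {t::real. x + t *\<^sub>R e \<in> A}"
  shows "AE x in lborel. x \<notin> A"
proof -
  have [measurable]: "A \<in> sets borel" by (rule A)
  have "AE t in lborel. x + t *\<^sub>R e \<notin> A" for x
  proof -
    have "AE t in lborel. t \<notin> {t. x + t *\<^sub>R e \<in> A}"
      by (intro AE_not_in finite_imp_null_set_lborel fin)
    then show ?thesis by simp
  qed
  then have "AE x in lborel. AE t in (lborel :: real measure). x + t *\<^sub>R e \<notin> A"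
    by simp
  also have "?this \<longleftrightarrow> (AE t in (lborel :: real measure). AE x in lborel. x + t *\<^sub>R e \<notin> A)"
    by (rule lborel_pair.AE_commute) measurable
  finally obtain t :: real where "AE x in lborel. x + t *\<^sub>R e \<notin> A"
    using eventually_happens[of _ "ae_filter lborel :: real filter"] by (auto simp: ae_filter_eq_bot_iff)
  then have "AE x in lborel. x \<in> {x. x + t *\<^sub>R e \<in> - A}" by simp
  moreover have "{x. x + t *\<^sub>R e \<in> - A} \<in> sets borel" by measurable
  \<comment> \<open>Translating back by \<open>- t *\<^sub>R e\<close> turns the null translate into
    \<open>A\<close> itself.\<close>
  ultimately have "AE x in lborel. - t *\<^sub>R e + 1 *\<^sub>R x \<in> {x. x + t *\<^sub>R e \<in> - A}"
    by (intro AE_lborel_affine) auto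
  then show ?thesis by simp
qed

section \<open>Support functions of nonempty compact sets\<close>

context
  fixes S :: "'a::euclidean_space set"
  assumes compact: "compact S" and nonempty: "S \<noteq> {}"
begin

lemma bdd_above_inner_image: "bdd_above ((\<lambda>y. y \<bullet> \<theta>) ` S)"
  by (intro bounded_imp_bdd_above compact_imp_bounded compact_continuous_image compact continuous_intros)

lemma inner_le_support_fun: "y \<in> S \<Longrightarrow> y \<bullet> \<theta> \<le> support_fun S \<theta>"
  unfolding support_fun_def by (rule cSUP_upper[OF _ bdd_above_inner_image])

lemma argmax_set_nonempty: "argmax_set S \<theta> \<noteq> {}"
proof -
  obtain y where "y \<in> S" "\<forall>z\<in>S. z \<bullet> \<theta> \<le> y \<bullet> \<theta>"
    using continuous_attains_sup[OF compact nonempty continuous_on_inner[OF continuous_on_id continuous_on_const]]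
    by blast
  moreover from this have "support_fun S \<theta> = y \<bullet> \<theta>"
    unfolding support_fun_def by (intro cSup_eq_maximum) auto
  ultimately show ?thesis by (auto simp: argmax_set_def)
qed

lemma is_arg_max_iff: "is_arg_max (\<lambda>y. y \<bullet> \<theta>) (\<lambda>y. y \<in> S) y \<longleftrightarrow> y \<in> argmax_set S \<theta>"
proof -
  obtain z where "z \<in> argmax_set S \<theta>" using argmax_set_nonempty by blast
  then show ?thesis
    using inner_le_support_fun[of _ \<theta>]
    unfolding is_arg_max_def argmax_set_def by (auto simp: not_less) (metis order_antisym)
qed

lemma unique_argmax_iff: "unique_argmax S \<theta> \<longleftrightarrow> (\<exists>y. argmax_set S \<theta> = {y})"
  unfolding unique_argmax_def is_arg_max_iff by auto

lemma argmax_point_eq: "argmax_set S \<theta> = {y} \<Longrightarrow> argmax_point S \<theta> = y"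
  unfolding argmax_point_def is_arg_max_iff using unique_argmax_iff by auto

lemma argmax_set_eq_singleton: "unique_argmax S \<theta> \<Longrightarrow> argmax_set S \<theta> = {argmax_point S \<theta>}"
  using argmax_point_eq unique_argmax_iff by auto

lemma convex_on_support_fun: "convex_on UNIV (support_fun S)"
proof (rule convex_onI)
  fix t :: real and x z :: 'a
  assume t: "0 < t" "t < 1"
  obtain y where y: "y \<in> S" "y \<bullet> ((1 - t) *\<^sub>R x + t *\<^sub>R z) = support_fun S ((1 - t) *\<^sub>R x + t *\<^sub>R z)"
    using argmax_set_nonempty unfolding argmax_set_def by blast
  have "(1 - t) * (y \<bullet> x) + t * (y \<bullet> z) \<le> (1 - t) * support_fun S x + t * support_fun S z"
    using t y by (intro add_mono mult_left_mono inner_le_support_fun) auto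
  then show "support_fun S ((1 - t) *\<^sub>R x + t *\<^sub>R z) \<le> (1 - t) * support_fun S x + t * support_fun S z"
    using y by (simp add: inner_add_right)
qed auto

text \<open>Since \<open>y\<close> lies in \<open>S\<close>, no term of the supremum is positive,
  and the term at \<open>\<theta> = 0\<close> is 0.\<close>

lemma fenchel_conjugate_support_fun: "y \<in> S \<Longrightarrow> fenchel_conjugate (support_fun S) y = 0"
proof (rule antisym)
  assume y: "y \<in> S"
  show "fenchel_conjugate (support_fun S) y \<le> 0"
    unfolding fenchel_conjugate_def
    using inner_le_support_fun[OF y] by (intro SUP_least) (simp add: inner_commute)
  have "support_fun S 0 = 0"
    unfolding support_fun_def using nonempty by simp
  then show "0 \<le> fenchel_conjugate (support_fun S) y"
    unfolding fenchel_conjugate_def by (intro SUP_upper2[of 0]) auto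
qed

lemma support_fun_lipschitz:
  assumes K: "\<And>y. y \<in> S \<Longrightarrow> norm y \<le> K"
  shows "\<bar>support_fun S \<theta> - support_fun S \<eta>\<bar> \<le> K * norm (\<theta> - \<eta>)"
proof -
  \<comment> \<open>A maximizer at \<open>\<theta>\<close> is a competitor at \<open>\<eta>\<close>,
    which bounds the difference in one direction; the other follows by exchanging the
    points.\<close>
  have *: "support_fun S \<theta> - support_fun S \<eta> \<le> K * norm (\<theta> - \<eta>)" for \<theta> \<eta>
  proof -
    obtain y where y: "y \<in> S" "y \<bullet> \<theta> = support_fun S \<theta>"
      using argmax_set_nonempty[of \<theta>] unfolding argmax_set_def by blast
    have "y \<bullet> (\<theta> - \<eta>) \<le> norm y * norm (\<theta> - \<eta>)" by (rule norm_cauchy_schwarz)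
    also have "\<dots> \<le> K * norm (\<theta> - \<eta>)" using K y by (simp add: mult_right_mono)
    finally show ?thesis
      using y inner_le_support_fun[of y \<eta>] by (simp add: inner_diff_right)
  qed
  show ?thesis
    using *[of \<theta> \<eta>] *[of \<eta> \<theta>] by (simp add: norm_minus_commute abs_le_iff)
qed

lemma continuous_on_support_fun [continuous_intros]:
  "continuous_on X g \<Longrightarrow> continuous_on X (\<lambda>x. support_fun S (g x))"
proof (rule continuous_on_compose2[of UNIV "support_fun S"])
  obtain K where K: "\<And>y. y \<in> S \<Longrightarrow> norm y \<le> K"
    using compact_imp_bounded[OF compact] unfolding bounded_iff by blast
  then have "0 \<le> K" using nonempty norm_ge_zero order_trans by blast
  then have "K-lipschitz_on UNIV (support_fun S)"
    using support_fun_lipschitz[OF K] by (intro lipschitz_onI) (auto simp: dist_norm)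
  then show "continuous_on UNIV (support_fun S)"
    by (rule lipschitz_on_continuous_on)
qed auto

section \<open>Stability of maximizers and differentiability of support functions\<close>

lemma argmax_set_near_argmax_point:
  assumes unique: "unique_argmax S \<theta>" and e: "e > 0"
  shows "\<exists>d>0. \<forall>\<eta>. norm (\<eta> - \<theta>) < d \<longrightarrow> (\<forall>z\<in>argmax_set S \<eta>. dist z (argmax_point S \<theta>) < e)"
proof (cases "S - ball (argmax_point S \<theta>) e = {}")
  case True
  then have "dist z (argmax_point S \<theta>) < e" if "z \<in> S" for z
    using that by (auto simp: dist_commute)
  then show ?thesis by (intro exI[of _ 1]) (auto simp: argmax_set_def)
next
  case False
  \<comment> \<open>\<open>gap\<close> measures the shortfall from the maximum at
    \<open>\<theta>\<close>. The point \<open>w\<close> obtained next has the least shortfall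
    outside the ball, and uniqueness makes it positive.\<close>
  define gap where "gap = (\<lambda>w. support_fun S \<theta> - w \<bullet> \<theta>)"
  obtain w where w: "w \<in> S - ball (argmax_point S \<theta>) e"
      "\<forall>z\<in>S - ball (argmax_point S \<theta>) e. z \<bullet> \<theta> \<le> w \<bullet> \<theta>"
    using continuous_attains_sup[OF compact_diff[OF compact open_ball] False
        continuous_on_inner[OF continuous_on_id continuous_on_const]]
    by blast
  have "w \<notin> argmax_set S \<theta>"
    using w e argmax_set_eq_singleton[OF unique] by auto
  then have gap: "gap w > 0"
    using w inner_le_support_fun[of w \<theta>] by (auto simp: gap_def argmax_set_def)
  obtain K where K: "K > 0" "\<And>y. y \<in> S \<Longrightarrow> norm y \<le> K"
    using compact_imp_bounded[OF compact] unfolding bounded_pos by blast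
  \<comment> \<open>Passing from \<open>\<theta>\<close> to \<open>\<eta>\<close> changes both
    \<open>z \<bullet> \<theta>\<close> and the support function by at most
    \<open>K * norm (\<eta> - \<theta>)\<close>. Two such changes must not bridge the gap, hence the
    radius \<open>gap w / (2 * K)\<close>.\<close>
  have "dist z (argmax_point S \<theta>) < e"
    if \<eta>: "norm (\<eta> - \<theta>) < gap w / (2 * K)" and z: "z \<in> argmax_set S \<eta>" for \<eta> z
  proof (rule ccontr)
    assume "\<not> dist z (argmax_point S \<theta>) < e"
    then have "z \<bullet> \<theta> \<le> w \<bullet> \<theta>"
      using w z by (auto simp: argmax_set_def dist_commute)
    moreover have "z \<bullet> (\<eta> - \<theta>) \<le> K * norm (\<eta> - \<theta>)"
      using norm_cauchy_schwarz[of z "\<eta> - \<theta>"] mult_right_mono[OF K(2)[of z] norm_ge_zero[of "\<eta> - \<theta>"]] z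
      by (simp add: argmax_set_def)
    moreover have "support_fun S \<theta> - support_fun S \<eta> \<le> K * norm (\<eta> - \<theta>)"
      using support_fun_lipschitz[OF K(2), of \<theta> \<eta>] by (simp add: norm_minus_commute)
    ultimately have "gap w \<le> 2 * K * norm (\<eta> - \<theta>)"
      using z by (simp add: gap_def argmax_set_def inner_diff_right)
    then show False using \<eta> K by (simp add: field_simps)
  qed
  then show ?thesis using gap K by (intro exI[of _ "gap w / (2 * K)"]) auto
qed

text \<open>For a maximizer \<open>z\<close> at \<open>\<theta> + v\<close>, the first-order
  remainder lies between 0 and \<open>(z - argmax_point S \<theta>) \<bullet> v\<close>: each
  maximizer is a competitor at the other's point. Stability of maximizers makes the upper bound
  small relative to \<open>norm v\<close>.\<close>

lemma GDERIV_support_fun: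
  assumes unique: "unique_argmax S \<theta>"
  shows "GDERIV (support_fun S) \<theta> :> argmax_point S \<theta>"
proof -
  let ?y = "argmax_point S \<theta>"
  have y: "?y \<in> S" "?y \<bullet> \<theta> = support_fun S \<theta>"
    using argmax_set_eq_singleton[OF unique] by (auto simp: argmax_set_def)
  have "\<exists>d>0. \<forall>v. v \<noteq> 0 \<and> norm v < d \<longrightarrow>
      norm (support_fun S (\<theta> + v) - support_fun S \<theta> - v \<bullet> ?y) / norm v < e" if e: "e > 0" for e
  proof -
    obtain d where d: "d > 0"
      "\<And>\<eta> z. norm (\<eta> - \<theta>) < d \<Longrightarrow> z \<in> argmax_set S \<eta> \<Longrightarrow> dist z ?y < e"
      using argmax_set_near_argmax_point[OF unique e] by blast
    have "norm (support_fun S (\<theta> + v) - support_fun S \<theta> - v \<bullet> ?y) / norm v < e"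
      if v: "v \<noteq> 0" "norm v < d" for v
    proof -
      obtain z where z: "z \<in> argmax_set S (\<theta> + v)" using argmax_set_nonempty by blast
      then have z': "z \<in> S" "z \<bullet> (\<theta> + v) = support_fun S (\<theta> + v)" by (auto simp: argmax_set_def)
      have "0 \<le> support_fun S (\<theta> + v) - support_fun S \<theta> - v \<bullet> ?y"
        using inner_le_support_fun[OF y(1), of "\<theta> + v"] y
        by (simp add: inner_add_right inner_commute)
      moreover have "support_fun S (\<theta> + v) - support_fun S \<theta> - v \<bullet> ?y \<le> (z - ?y) \<bullet> v"
        using inner_le_support_fun[OF z'(1), of \<theta>] z'
        by (simp add: inner_add_right inner_diff_left inner_commute[of v])
      moreover have "(z - ?y) \<bullet> v \<le> norm (z - ?y) * norm v" by (rule norm_cauchy_schwarz)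
      moreover have "norm (z - ?y) * norm v < e * norm v"
        using d(2)[OF _ z] v by (simp add: dist_norm)
      ultimately have "norm (support_fun S (\<theta> + v) - support_fun S \<theta> - v \<bullet> ?y) < e * norm v"
        by simp
      then show ?thesis using v by (simp add: pos_divide_less_eq)
    qed
    with d(1) show ?thesis by blast
  qed
  then have "((\<lambda>v. norm (support_fun S (\<theta> + v) - support_fun S \<theta> - v \<bullet> ?y) / norm v) \<longlongrightarrow> 0) (at 0)"
    unfolding LIM_def by (simp add: dist_norm)
  then show ?thesis
    unfolding gderiv_def has_derivative_at by (auto intro: bounded_linear_inner_left)
qed

section \<open>Uniqueness of the maximizer almost everywhere\<close>

lemma closed_ambiguous: "closed (ambiguous S e \<delta>)"
proof -
  \<comment> \<open>The condition is closed in the triple of two maximizers and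
    \<open>\<theta>\<close>; projecting along the compact factor \<open>S \<times> S\<close>
    preserves closedness.\<close>
  have "closed {q :: ('a \<times> 'a) \<times> 'a. fst (fst q) \<bullet> snd q = support_fun S (snd q) \<and>
      snd (fst q) \<bullet> snd q = support_fun S (snd q) \<and> \<delta> \<le> (fst (fst q) - snd (fst q)) \<bullet> e}" (is "closed ?T")
    by (intro closed_Collect_conj closed_Collect_eq closed_Collect_le continuous_intros)
  from closed_compact_projection[OF compact_Times[OF compact compact] this]
  have "closed {\<theta>. \<exists>q. q \<in> S \<times> S \<and> (q, \<theta>) \<in> ?T}" .
  also have "{\<theta>. \<exists>q. q \<in> S \<times> S \<and> (q, \<theta>) \<in> ?T} = ambiguous S e \<delta>"
    by (auto simp: ambiguous_def argmax_set_def)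
  finally show ?thesis .
qed

text \<open>This is monotonicity of the subdifferential: adding the optimality inequalities of
  \<open>y\<close> and \<open>z\<close>, each against the other, cancels the terms in
  \<open>x\<close>.\<close>

lemma argmax_set_mono_on_line:
  assumes "y \<in> argmax_set S (x + s *\<^sub>R e)" "z \<in> argmax_set S (x + t *\<^sub>R e)" "s < t"
  shows "y \<bullet> e \<le> z \<bullet> e"
proof -
  have "y \<bullet> (x + t *\<^sub>R e) \<le> z \<bullet> (x + t *\<^sub>R e)" "z \<bullet> (x + s *\<^sub>R e) \<le> y \<bullet> (x + s *\<^sub>R e)"
    using assms inner_le_support_fun by (auto simp: argmax_set_def)
  then have "0 \<le> (t - s) * (z \<bullet> e - y \<bullet> e)"
    by (simp add: inner_add_right algebra_simps)
  then show ?thesis using assms(3) by (simp add: zero_le_mult_iff)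
qed

text \<open>By monotonicity the intervals of values of \<open>y \<bullet> e\<close>, over the maximizers \<open>y\<close> at the
  successive ambiguous points of a line, do not overlap; each has length at least \<open>\<delta>\<close>.\<close>
lemma finite_ambiguous_on_line:
  assumes \<delta>: "\<delta> > 0"
  shows "finite {t::real. x + t *\<^sub>R e \<in> ambiguous S e \<delta>}"
proof -
  obtain K where K: "\<And>y. y \<in> S \<Longrightarrow> norm y \<le> K"
    using compact_imp_bounded[OF compact] unfolding bounded_iff by blast
  define L where "L = K * norm e"
  have L: "\<bar>y \<bullet> e\<bar> \<le> L" if "y \<in> S" for y
    using Cauchy_Schwarz_ineq2[of y e] mult_right_mono[OF K[OF that], of "norm e"]
    by (simp add: L_def)
  \<comment> \<open>Starting from the lower bound \<open>- L\<close>, every ambiguous point to the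
    left of \<open>u\<close> raises the value along \<open>e\<close> by at least
    \<open>\<delta>\<close>.\<close>
  have step: "- L + \<delta> * card T \<le> z \<bullet> e"
    if "finite T" "\<forall>t\<in>T. x + t *\<^sub>R e \<in> ambiguous S e \<delta> \<and> t < u" "z \<in> argmax_set S (x + u *\<^sub>R e)" for T u z
    using that
  proof (induction T arbitrary: u z rule: finite_linorder_max_induct)
    case empty
    then show ?case using L[of z] by (auto simp: argmax_set_def)
  next
    case (insert b T)
    then obtain y y' where y: "y \<in> argmax_set S (x + b *\<^sub>R e)" "y' \<in> argmax_set S (x + b *\<^sub>R e)"
        "\<delta> \<le> (y - y') \<bullet> e"
      by (auto simp: ambiguous_def)
    \<comment> \<open>The induction adds the largest point \<open>b\<close>. The hypothesis, with
      \<open>b\<close> as new right end, bounds the lower value \<open>y' \<bullet> e\<close>; the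
      jump at \<open>b\<close> leads up to \<open>y \<bullet> e\<close>, and monotonicity from there
      to \<open>z \<bullet> e\<close>.\<close>
    have "- L + \<delta> * card T \<le> y' \<bullet> e"
      using insert.prems insert.hyps y by (intro insert.IH) auto
    moreover have "y \<bullet> e \<le> z \<bullet> e"
      using insert.prems y by (intro argmax_set_mono_on_line[of y x b e z u]) auto
    moreover have "b \<notin> T" using insert.hyps by auto
    ultimately show ?case
      using y insert.hyps by (simp add: inner_diff_left algebra_simps)
  qed
  \<comment> \<open>All values along \<open>e\<close> lie between \<open>- L\<close> and
    \<open>L\<close>, which leaves room for at most \<open>2 * L / \<delta>\<close> jumps. A uniform
    bound on finite subsets yields finiteness.\<close>
  have "card T \<le> nat \<lceil>2 * L / \<delta>\<rceil>"
    if T: "finite T" "T \<subseteq> {t. x + t *\<^sub>R e \<in> ambiguous S e \<delta>}" for T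
  proof -
    obtain u where u: "\<forall>t\<in>T. t < u"
      using T(1) finite_imp_bounded bounded_imp_bdd_above by (meson bdd_above_def gt_ex le_less_trans)
    obtain z where z: "z \<in> argmax_set S (x + u *\<^sub>R e)" using argmax_set_nonempty by blast
    have "- L + \<delta> * card T \<le> z \<bullet> e"
      using u T z by (intro step) auto
    also have "\<dots> \<le> L" using L[of z] z by (auto simp: argmax_set_def)
    finally have "card T \<le> 2 * L / \<delta>" using \<delta> by (simp add: field_simps)
    then show ?thesis by linarith
  qed
  then show ?thesis
    by (intro finite_if_finite_subsets_card_bdd[THEN conjunct1]) auto
qed

text \<open>Distinct maximizers differ in some coordinate by more than some
  \<open>1 / Suc n\<close>. Non-uniqueness thus becomes a countable union of closed sets, which
  serves both measurability and the null set argument.\<close>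

lemma not_unique_argmax_iff:
  "\<not> unique_argmax S \<theta> \<longleftrightarrow> (\<exists>e\<in>Basis. \<exists>n::nat. \<theta> \<in> ambiguous S e (1 / Suc n))"
proof
  assume "\<not> unique_argmax S \<theta>"
  then obtain y z where yz: "y \<in> argmax_set S \<theta>" "z \<in> argmax_set S \<theta>" "y \<noteq> z"
    using argmax_set_nonempty[of \<theta>] unfolding unique_argmax_iff by blast
  then obtain e where e: "e \<in> Basis" "y \<bullet> e \<noteq> z \<bullet> e"
    using euclidean_eq_iff by blast
  then obtain n :: nat where "1 / Suc n < \<bar>y \<bullet> e - z \<bullet> e\<bar>"
    using nat_approx_posE[of "\<bar>y \<bullet> e - z \<bullet> e\<bar>"] by auto
  \<comment> \<open>The sign of the difference is harmless because the two maximizers may be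
    exchanged.\<close>
  then have "1 / Suc n \<le> (y - z) \<bullet> e \<or> 1 / Suc n \<le> (z - y) \<bullet> e"
    by (auto simp: inner_diff_left abs_if split: if_splits)
  then have "\<theta> \<in> ambiguous S e (1 / Suc n)"
    unfolding ambiguous_def using yz by blast
  then show "\<exists>e\<in>Basis. \<exists>n::nat. \<theta> \<in> ambiguous S e (1 / Suc n)"
    using e by blast
next
  assume "\<exists>e\<in>Basis. \<exists>n::nat. \<theta> \<in> ambiguous S e (1 / Suc n)"
  then obtain e n y z where "y \<in> argmax_set S \<theta>" "z \<in> argmax_set S \<theta>" "1 / Suc n \<le> (y - z) \<bullet> e"
    unfolding ambiguous_def by blast
  moreover from this(3) have "y \<noteq> z" by (auto simp: not_le)
  ultimately show "\<not> unique_argmax S \<theta>"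
    unfolding unique_argmax_iff by auto
qed

lemma sets_unique_argmax [measurable]: "{\<theta>. unique_argmax S \<theta>} \<in> sets borel"
proof -
  have "{\<theta>. unique_argmax S \<theta>} = - (\<Union>e\<in>Basis. \<Union>n::nat. ambiguous S e (1 / Suc n))"
    using not_unique_argmax_iff by auto
  also have "\<dots> \<in> sets borel"
    by (intro borel_comp sets.finite_UN sets.countable_UN) (auto intro: borel_closed closed_ambiguous)
  finally show ?thesis .
qed

lemma AE_unique_argmax: "AE \<theta> in lborel. unique_argmax S \<theta>"
proof -
  have "AE \<theta> in lborel. \<forall>e\<in>Basis. \<forall>n::nat. \<theta> \<notin> ambiguous S e (1 / Suc n)"
    unfolding AE_all_countable
    by (intro AE_finite_allI finite_Basis) (auto simp: AE_all_countable
        intro!: AE_lborel_finite_on_lines[OF borel_closed[OF closed_ambiguous] finite_ambiguous_on_line])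
  then show ?thesis
    by eventually_elim (use not_unique_argmax_iff in blast)
qed

section \<open>Measurability and integrability of the maximizer\<close>

lemma borel_measurable_argmax_point [measurable]: "argmax_point S \<in> borel_measurable borel"
proof -
  \<comment> \<open>By stability the maximizer varies continuously on the Borel set where it is
    unique; off that set it has the constant value 0.\<close>
  have "continuous_on {\<theta>. unique_argmax S \<theta>} (argmax_point S)"
    unfolding continuous_on_iff
  proof safe
    fix \<theta> and e :: real
    assume "unique_argmax S \<theta>" "0 < e"
    then obtain d where d: "d > 0"
      "\<And>\<eta> z. norm (\<eta> - \<theta>) < d \<Longrightarrow> z \<in> argmax_set S \<eta> \<Longrightarrow> dist z (argmax_point S \<theta>) < e"
      using argmax_set_near_argmax_point by blast
    then show "\<exists>d>0. \<forall>\<eta>\<in>{\<theta>. unique_argmax S \<theta>}. dist \<eta> \<theta> < d \<longrightarrow>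
        dist (argmax_point S \<eta>) (argmax_point S \<theta>) < e"
      by (auto simp: dist_norm[of _ \<theta>] argmax_set_eq_singleton)
  qed
  then have "(\<lambda>\<theta>. if \<theta> \<in> {\<theta>. unique_argmax S \<theta>} then argmax_point S \<theta> else 0) \<in> borel_measurable borel"
    by (intro borel_measurable_continuous_on_if sets_unique_argmax) auto
  also have "(\<lambda>\<theta>. if \<theta> \<in> {\<theta>. unique_argmax S \<theta>} then argmax_point S \<theta> else 0) = argmax_point S"
    by (auto simp: argmax_point_def)
  finally show ?thesis .
qed

lemma integrable_argmax_point:
  assumes "finite_measure M" and [measurable]: "g \<in> borel_measurable M"
  shows "integrable M (\<lambda>\<omega>. argmax_point S (g \<omega>))"
proof -
  interpret finite_measure M by fact
  obtain K where K: "K > 0" "\<And>y. y \<in> S \<Longrightarrow> norm y \<le> K"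
    using compact_imp_bounded[OF compact] unfolding bounded_pos by blast
  \<comment> \<open>The default value 0 need not belong to \<open>S\<close>; the positive choice of
    \<open>K\<close> covers it as well.\<close>
  have "norm (argmax_point S \<theta>) \<le> K" for \<theta>
  proof (cases "unique_argmax S \<theta>")
    case True
    then show ?thesis using argmax_set_eq_singleton[OF True] K by (auto simp: argmax_set_def)
  next
    case False
    then show ?thesis using K by (simp add: argmax_point_def)
  qed
  then show ?thesis
    by (intro integrable_const_bound[of _ K]) auto
qed

end

section \<open>Partial Fenchel-Young losses and their perturbation\<close>

lemma FY_loss_support_fun:
  fixes C :: "'a::euclidean_space set"
  assumes "compact C" "y \<in> C"
  shows "FY_loss (support_fun C) \<theta> y = ereal (support_fun C \<theta> - y \<bullet> \<theta>)"
proof -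
  have "fenchel_conjugate (support_fun C) y = 0"
    using assms by (intro fenchel_conjugate_support_fun) auto
  then show ?thesis by (simp add: FY_loss_def inner_commute)
qed

text \<open>On \<open>S\<close> the conjugate term vanishes, so minimizing the loss amounts to
  maximizing \<open>y \<bullet> \<theta>\<close>; compactness provides a maximizer at which the
  infimum is attained.\<close>

lemma partial_FY_loss_support_fun:
  fixes C :: "'a::euclidean_space set"
  assumes "compact C" "compact S" "S \<noteq> {}" "S \<subseteq> C"
  shows "partial_FY_loss (support_fun C) S \<theta> = ereal (support_fun C \<theta> - support_fun S \<theta>)"
proof (rule antisym)
  obtain y where y: "y \<in> S" "y \<bullet> \<theta> = support_fun S \<theta>"
    using argmax_set_nonempty[OF assms(2,3), of \<theta>] by (auto simp: argmax_set_def)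
  then show "partial_FY_loss (support_fun C) S \<theta> \<le> ereal (support_fun C \<theta> - support_fun S \<theta>)"
    unfolding partial_FY_loss_def using assms
    by (intro INF_lower2[of y]) (auto simp: FY_loss_support_fun)
  show "ereal (support_fun C \<theta> - support_fun S \<theta>) \<le> partial_FY_loss (support_fun C) S \<theta>"
    unfolding partial_FY_loss_def
  proof (rule INF_greatest)
    fix y assume "y \<in> S"
    then show "ereal (support_fun C \<theta> - support_fun S \<theta>) \<le> FY_loss (support_fun C) \<theta> y"
      using assms inner_le_support_fun[OF assms(2,3), of y \<theta>] by (auto simp: FY_loss_support_fun)
  qed
qed

text \<open>The loss has Lipschitz constant \<open>2 * K\<close>, one \<open>K\<close> from each
  support function. As \<open>M\<close> is finite, this constant is an integrable bound for
  differentiating under the integral.\<close>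

lemma GDERIV_perturbed_partial_FY_loss:
  fixes C :: "'a::euclidean_space set" and Z :: "'w \<Rightarrow> 'a"
  assumes "finite_measure M" and [measurable]: "Z \<in> borel_measurable M"
    and C: "compact C" and S: "compact S" "S \<noteq> {}" "S \<subseteq> C"
    and int: "integrable M (\<lambda>\<omega>. support_fun C (\<theta> + \<epsilon> *\<^sub>R Z \<omega>) - support_fun S (\<theta> + \<epsilon> *\<^sub>R Z \<omega>))"
    and unique: "AE \<omega> in M. unique_argmax C (\<theta> + \<epsilon> *\<^sub>R Z \<omega>) \<and> unique_argmax S (\<theta> + \<epsilon> *\<^sub>R Z \<omega>)"
  shows "GDERIV (perturbed_partial_FY_loss M Z \<epsilon> (support_fun C) S) \<theta>
      :> perturbed_argmax M Z \<epsilon> C \<theta> - perturbed_argmax M Z \<epsilon> S \<theta>"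
proof -
  interpret finite_measure M by fact
  have "C \<noteq> {}" using S by auto
  note C = C this
  define l where "l \<theta> = support_fun C \<theta> - support_fun S \<theta>" for \<theta>
  obtain K where K: "\<And>y. y \<in> C \<Longrightarrow> norm y \<le> K"
    using compact_imp_bounded[OF C(1)] unfolding bounded_iff by blast
  have l_lipschitz: "\<bar>l x - l y\<bar> \<le> 2 * K * norm (x - y)" for x y
  proof -
    have "\<bar>support_fun S x - support_fun S y\<bar> \<le> K * norm (x - y)"
      using K S by (intro support_fun_lipschitz) auto
    moreover have "\<bar>support_fun C x - support_fun C y\<bar> \<le> K * norm (x - y)"
      using K C by (intro support_fun_lipschitz) auto
    ultimately show ?thesis unfolding l_def by linarith
  qed
  have "continuous_on UNIV l"
    unfolding l_def using C S by (intro continuous_intros) auto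
  then have [measurable]: "l \<in> borel_measurable borel"
    by (rule borel_measurable_continuous_onI)
  \<comment> \<open>By the Lipschitz bound, losses at \<open>x\<close> and at
    \<open>\<theta>\<close> differ by a bounded function, so integrability at
    \<open>\<theta>\<close> carries over to every \<open>x\<close>.\<close>
  have int_l: "integrable M (\<lambda>\<omega>. l (x + \<epsilon> *\<^sub>R Z \<omega>))" for x
  proof -
    have "norm (l (x + \<epsilon> *\<^sub>R Z \<omega>) - l (\<theta> + \<epsilon> *\<^sub>R Z \<omega>)) \<le> 2 * K * norm (x - \<theta>)" for \<omega>
      using l_lipschitz[of "x + \<epsilon> *\<^sub>R Z \<omega>" "\<theta> + \<epsilon> *\<^sub>R Z \<omega>"] by simp
    then have "integrable M (\<lambda>\<omega>. l (x + \<epsilon> *\<^sub>R Z \<omega>) - l (\<theta> + \<epsilon> *\<^sub>R Z \<omega>))"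
      by (intro integrable_const_bound[of _ "2 * K * norm (x - \<theta>)"]) auto
    from Bochner_Integration.integrable_add[OF this int[folded l_def]] show ?thesis by simp
  qed
  have int_argmax: "integrable M (\<lambda>\<omega>. argmax_point C (\<theta> + \<epsilon> *\<^sub>R Z \<omega>))"
      "integrable M (\<lambda>\<omega>. argmax_point S (\<theta> + \<epsilon> *\<^sub>R Z \<omega>))"
    using C S by (auto intro!: integrable_argmax_point finite_measure_axioms)
  have "GDERIV (\<lambda>x. LINT \<omega>|M. l (x + \<epsilon> *\<^sub>R Z \<omega>)) \<theta>
      :> (LINT \<omega>|M. argmax_point C (\<theta> + \<epsilon> *\<^sub>R Z \<omega>) - argmax_point S (\<theta> + \<epsilon> *\<^sub>R Z \<omega>))"
  proof (rule GDERIV_integral[where B = "\<lambda>_. 2 * K"])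
    show "AE \<omega> in M. GDERIV (\<lambda>x. l (x + \<epsilon> *\<^sub>R Z \<omega>)) \<theta>
        :> argmax_point C (\<theta> + \<epsilon> *\<^sub>R Z \<omega>) - argmax_point S (\<theta> + \<epsilon> *\<^sub>R Z \<omega>)"
      using unique
    proof eventually_elim
      case (elim \<omega>)
      then have "GDERIV l (\<theta> + \<epsilon> *\<^sub>R Z \<omega>)
          :> argmax_point C (\<theta> + \<epsilon> *\<^sub>R Z \<omega>) - argmax_point S (\<theta> + \<epsilon> *\<^sub>R Z \<omega>)"
        unfolding l_def using C S by (intro GDERIV_diff GDERIV_support_fun) auto
      then show ?case
        \<comment> \<open>The limit form of the derivative contains only increments, so the shift by
          \<open>\<epsilon> *\<^sub>R Z \<omega>\<close> moves from the function to the base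
          point.\<close>
        unfolding gderiv_def has_derivative_at by (simp add: algebra_simps)
    qed
    show "\<bar>l (x + \<epsilon> *\<^sub>R Z \<omega>) - l (y + \<epsilon> *\<^sub>R Z \<omega>)\<bar> \<le> 2 * K * norm (x - y)" for x y \<omega>
      using l_lipschitz[of "x + \<epsilon> *\<^sub>R Z \<omega>" "y + \<epsilon> *\<^sub>R Z \<omega>"] by simp
  qed (use int_l int_argmax in auto)
  moreover have "perturbed_partial_FY_loss M Z \<epsilon> (support_fun C) S = (\<lambda>x. LINT \<omega>|M. l (x + \<epsilon> *\<^sub>R Z \<omega>))"
    unfolding perturbed_partial_FY_loss_def l_def
    using C S by (auto simp: fun_eq_iff partial_FY_loss_support_fun)
  ultimately show ?thesis
    unfolding perturbed_argmax_def using int_argmax by simp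
qed

theorem proposition1:
  fixes C :: "(real ^ 'd) set"
    and P :: "'p set"
    and Cp :: "'p \<Rightarrow> (real ^ 'd) set"
    and M :: "'w measure"
    and Z :: "'w \<Rightarrow> real ^ 'd"
    and f :: "real ^ 'd \<Rightarrow> real"
    and \<epsilon> :: real
  defines "F \<equiv> support_fun C"
  assumes "compact C" and "convex C"
    and "\<And>p. p \<in> P \<Longrightarrow> Cp p \<subseteq> C"
    and "\<And>p. p \<in> P \<Longrightarrow> convex (Cp p)"
    and "\<And>p. p \<in> P \<Longrightarrow> closed (Cp p)"
    and "\<And>p. p \<in> P \<Longrightarrow> Cp p \<noteq> {}"
    and "prob_space M"
    and "distributed M lborel Z (\<lambda>z. ennreal (f z))"
    and "\<And>z. f z > 0"
    and "f differentiable_on UNIV"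
    and "\<epsilon> > 0"
  shows "\<forall>p\<in>P.
     (convex_on UNIV F \<and> convex_on UNIV (support_fun (Cp p)) \<and>
      (\<forall>\<theta>. partial_FY_loss F (Cp p) \<theta> = ereal (F \<theta> - support_fun (Cp p) \<theta>) \<and>
           (\<exists>y\<in>Cp p. FY_loss F \<theta> y = partial_FY_loss F (Cp p) \<theta>) \<and>
           (\<exists>y\<in>C. y \<bullet> \<theta> = F \<theta>) \<and>
           (\<exists>y\<in>Cp p. y \<bullet> \<theta> = support_fun (Cp p) \<theta>)))
   \<and> ((\<forall>\<theta>. unique_argmax C \<theta> \<and> unique_argmax (Cp p) \<theta> \<longrightarrow>
           (GDERIV (\<lambda>\<theta>. real_of_ereal (partial_FY_loss F (Cp p) \<theta>)) \<theta>
              :> argmax_point C \<theta> - argmax_point (Cp p) \<theta>)) \<and>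
      (AE \<theta> in lborel. unique_argmax C \<theta> \<and> unique_argmax (Cp p) \<theta>))
   \<and> (\<forall>\<theta>.
        (AE \<omega> in M. unique_argmax C (\<theta> + \<epsilon> *\<^sub>R Z \<omega>) \<and> unique_argmax (Cp p) (\<theta> + \<epsilon> *\<^sub>R Z \<omega>)) \<and>
        integrable M (\<lambda>\<omega>. argmax_point C (\<theta> + \<epsilon> *\<^sub>R Z \<omega>)) \<and>
        integrable M (\<lambda>\<omega>. argmax_point (Cp p) (\<theta> + \<epsilon> *\<^sub>R Z \<omega>)) \<and>
        (integrable M (\<lambda>\<omega>. real_of_ereal (partial_FY_loss F (Cp p) (\<theta> + \<epsilon> *\<^sub>R Z \<omega>))) \<longrightarrow>
           (GDERIV (\<lambda>\<theta>. perturbed_partial_FY_loss M Z \<epsilon> F (Cp p) \<theta>) \<theta>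
              :> perturbed_argmax M Z \<epsilon> C \<theta> - perturbed_argmax M Z \<epsilon> (Cp p) \<theta>)))"
proof (intro ballI)
  fix p assume p: "p \<in> P"
  note sub = assms(4)[OF p] and closed = assms(6)[OF p] and nonempty = assms(7)[OF p]
  \<comment> \<open>\<open>Cp p\<close> is compact as the intersection of \<open>C\<close> with a
    closed set.\<close>
  have S: "compact (Cp p)" "Cp p \<noteq> {}" "Cp p \<subseteq> C"
    using compact_Int_closed[OF assms(2) closed] by (simp_all only: nonempty sub Int_absorb1 not_False_eq_True)
  have C: "compact C" "C \<noteq> {}"
    using nonempty sub by (simp_all only: assms(2)) blast
  interpret prob_space M by fact
  have Z [measurable]: "Z \<in> borel_measurable M"
    using assms(9) by (simp add: distributed_def)
  have loss: "partial_FY_loss F (Cp p) \<theta> = ereal (F \<theta> - support_fun (Cp p) \<theta>)" for \<theta>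
    unfolding F_def using C S by (intro partial_FY_loss_support_fun) auto
  have attained_C: "\<exists>y\<in>C. y \<bullet> \<theta> = F \<theta>" for \<theta>
    using argmax_set_nonempty[OF C, of \<theta>] by (auto simp: argmax_set_def F_def)
  have attained_S: "\<exists>y\<in>Cp p. y \<bullet> \<theta> = support_fun (Cp p) \<theta>" for \<theta>
    using argmax_set_nonempty[OF S(1,2), of \<theta>] by (auto simp: argmax_set_def)
  have attained_loss: "\<exists>y\<in>Cp p. FY_loss F \<theta> y = partial_FY_loss F (Cp p) \<theta>" for \<theta>
  proof -
    obtain y where y: "y \<in> Cp p" "y \<bullet> \<theta> = support_fun (Cp p) \<theta>"
      using attained_S by blast
    then have "FY_loss F \<theta> y = ereal (F \<theta> - y \<bullet> \<theta>)"
      unfolding F_def using S(3) by (intro FY_loss_support_fun C(1)) blast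
    with y show ?thesis unfolding loss by (intro bexI[of _ y]) simp_all
  qed
  have AE_lborel: "AE \<theta> in lborel. unique_argmax C \<theta> \<and> unique_argmax (Cp p) \<theta>"
    using AE_unique_argmax[OF C] AE_unique_argmax[OF S(1,2)] by eventually_elim blast
  have "{\<theta>. unique_argmax C \<theta> \<and> unique_argmax (Cp p) \<theta>} \<in> sets borel"
    unfolding Collect_conj_eq by (intro sets.Int sets_unique_argmax C S)
  \<comment> \<open>With \<open>\<epsilon>\<close> nonzero, uniqueness Lebesgue-almost everywhere
    transfers to \<open>\<theta> + \<epsilon> *\<^sub>R Z \<omega>\<close> for every
    \<open>\<theta>\<close>, not merely almost every one.\<close>
  from AE_distributed_lborel_affine[OF assms(9) _ this, of \<epsilon>]
  have AE_M: "AE \<omega> in M. unique_argmax C (\<theta> + \<epsilon> *\<^sub>R Z \<omega>) \<and> unique_argmax (Cp p) (\<theta> + \<epsilon> *\<^sub>R Z \<omega>)" for \<theta>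
    using assms(12) AE_lborel by simp
  have gradient: "GDERIV (\<lambda>\<theta>. F \<theta> - support_fun (Cp p) \<theta>) \<theta> :> argmax_point C \<theta> - argmax_point (Cp p) \<theta>"
    if "unique_argmax C \<theta> \<and> unique_argmax (Cp p) \<theta>" for \<theta>
    unfolding F_def using that by (intro GDERIV_diff GDERIV_support_fun C S) blast+
  have integrable: "integrable M (\<lambda>\<omega>. argmax_point C (\<theta> + \<epsilon> *\<^sub>R Z \<omega>))"
      "integrable M (\<lambda>\<omega>. argmax_point (Cp p) (\<theta> + \<epsilon> *\<^sub>R Z \<omega>))" for \<theta>
    by (intro integrable_argmax_point finite_measure_axioms C S; measurable)+
  have perturbed_gradient: "GDERIV (\<lambda>\<theta>. perturbed_partial_FY_loss M Z \<epsilon> F (Cp p) \<theta>) \<theta>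
      :> perturbed_argmax M Z \<epsilon> C \<theta> - perturbed_argmax M Z \<epsilon> (Cp p) \<theta>"
    if "integrable M (\<lambda>\<omega>. F (\<theta> + \<epsilon> *\<^sub>R Z \<omega>) - support_fun (Cp p) (\<theta> + \<epsilon> *\<^sub>R Z \<omega>))" for \<theta>
    using that unfolding F_def
    by (intro GDERIV_perturbed_partial_FY_loss finite_measure_axioms Z C S AE_M)
  have convex: "convex_on UNIV F" "convex_on UNIV (support_fun (Cp p))"
    unfolding F_def by (rule convex_on_support_fun[OF C] convex_on_support_fun[OF S(1,2)])+
  show "(convex_on UNIV F \<and> convex_on UNIV (support_fun (Cp p)) \<and>
      (\<forall>\<theta>. partial_FY_loss F (Cp p) \<theta> = ereal (F \<theta> - support_fun (Cp p) \<theta>) \<and>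
           (\<exists>y\<in>Cp p. FY_loss F \<theta> y = partial_FY_loss F (Cp p) \<theta>) \<and>
           (\<exists>y\<in>C. y \<bullet> \<theta> = F \<theta>) \<and>
           (\<exists>y\<in>Cp p. y \<bullet> \<theta> = support_fun (Cp p) \<theta>)))
   \<and> ((\<forall>\<theta>. unique_argmax C \<theta> \<and> unique_argmax (Cp p) \<theta> \<longrightarrow>
           (GDERIV (\<lambda>\<theta>. real_of_ereal (partial_FY_loss F (Cp p) \<theta>)) \<theta>
              :> argmax_point C \<theta> - argmax_point (Cp p) \<theta>)) \<and>
      (AE \<theta> in lborel. unique_argmax C \<theta> \<and> unique_argmax (Cp p) \<theta>))
   \<and> (\<forall>\<theta>.
        (AE \<omega> in M. unique_argmax C (\<theta> + \<epsilon> *\<^sub>R Z \<omega>) \<and> unique_argmax (Cp p) (\<theta> + \<epsilon> *\<^sub>R Z \<omega>)) \<and>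
        integrable M (\<lambda>\<omega>. argmax_point C (\<theta> + \<epsilon> *\<^sub>R Z \<omega>)) \<and>
        integrable M (\<lambda>\<omega>. argmax_point (Cp p) (\<theta> + \<epsilon> *\<^sub>R Z \<omega>)) \<and>
        (integrable M (\<lambda>\<omega>. real_of_ereal (partial_FY_loss F (Cp p) (\<theta> + \<epsilon> *\<^sub>R Z \<omega>))) \<longrightarrow>
           (GDERIV (\<lambda>\<theta>. perturbed_partial_FY_loss M Z \<epsilon> F (Cp p) \<theta>) \<theta>
              :> perturbed_argmax M Z \<epsilon> C \<theta> - perturbed_argmax M Z \<epsilon> (Cp p) \<theta>)))"
    \<comment> \<open>Since the loss is finite everywhere, \<open>real_of_ereal\<close> disappears
      and the goals match the facts about the real-valued difference.\<close>
    unfolding real_of_ereal.simps loss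
    by (intro conjI allI impI; (rule refl convex attained_C attained_S attained_loss[unfolded loss]
          AE_lborel AE_M integrable | erule gradient perturbed_gradient))
qed

end
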